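(* Let $\Phi$ be a Drinfeld $A$-module of rank $2$ over the finite field $L$, where $A=\mathbf{F}_q[T]$. Then there exist two ideals $I_1$ and $I_2$ of $A$ such that the finite $A$-module $L^\Phi$ is isomorphic to $\frac{A}{I_1}\oplus\frac{A}{I_2}$ and $\chi_\Phi=I_1I_2$.
   Context: Let $A=\mathbf{F}_q[T]$, and let $L$ be a finite field, finite extension of $\mathbf{F}_q$, equipped with an $\mathbf{F}_q$-algebra homomorphism $\gamma:A\to L$. Let $\tau:x\mapsto x^q$ and let $L\{\tau\}$ be the Ore polynomial ring with $\tau\lambda=\lambda^q\tau$ for $\lambda\in L$. A Drinfeld $A$-module of rank $2$ over $L$ is an $\mathbf{F}_q$-algebra homomorphism $\Phi:A\to L\{\tau\}$, $a\mapsto\Phi_a$, with $\Phi_T=\gamma(T)+a_2\tau+a_3\tau^2$, $a_2\in L$, $a_3\in L^{*}$. $L^\Phi$ denotes the finite $A$-module with underlying group $L$ and action $a\cdot x=\Phi_a(x)$. The Euler-Poincaré characteristic $\chi(N)$ of a finite $A$-module $N\simeq\bigoplus_j A/J_j$ ($J_j$ nonzero ideals) is the ideal $\prod_j J_j$ of $A$; put $\chi_\Phi=\chi(L^\Phi)$. *)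

theory Defs
  imports
    "HOL-Algebra.Algebraic_Closure_Type"
    "HOL-Algebra.Chinese_Remainder"
    "HOL-Algebra.Ideal_Product"
    "HOL-Algebra.Module"
    "HOL-Library.Cardinality"
begin

text \<open>
  The library's module record extends the ring record. In the modules below its multiplicative
  fields are inherited from the underlying rings and play no role.
\<close>

definition quotient_module :: "('a, 'm) ring_scheme \<Rightarrow> 'a set \<Rightarrow> ('a, 'a set) module"
  where "quotient_module R I =
    ring.extend (R Quot I) (module.fields (\<lambda>a C. (I +>\<^bsub>R\<^esub> a) \<otimes>\<^bsub>R Quot I\<^esub> C))"

definition direct_sum :: "('a, 'b) module list \<Rightarrow> ('a, 'b list) module"
  where "direct_sum Ms =
    ring.extend (RDirProd_list Ms)
      (module.fields (\<lambda>a xs. map2 (\<lambda>M x. a \<odot>\<^bsub>M\<^esub> x) Ms xs))"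

definition module_iso :: "('a, 'm) ring_scheme \<Rightarrow> ('a, 'b) module \<Rightarrow> ('a, 'c) module \<Rightarrow> ('b \<Rightarrow> 'c) set"
  where "module_iso R M N = {h. bij_betw h (carrier M) (carrier N) \<and>
    (\<forall>x \<in> carrier M. \<forall>y \<in> carrier M. h (x \<oplus>\<^bsub>M\<^esub> y) = h x \<oplus>\<^bsub>N\<^esub> h y) \<and>
    (\<forall>a \<in> carrier R. \<forall>x \<in> carrier M. h (a \<odot>\<^bsub>M\<^esub> x) = a \<odot>\<^bsub>N\<^esub> h x)}"

definition modules_isomorphic :: "('a, 'm) ring_scheme \<Rightarrow> ('a, 'b) module \<Rightarrow> ('a, 'c) module \<Rightarrow> bool"
  where "modules_isomorphic R M N \<longleftrightarrow> module_iso R M N \<noteq> {}"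

text \<open>
  The empty list is allowed and accounts for the zero module, whose characteristic is the unit
  ideal. For the finite modules over a principal ideal domain such as \<open>F\<^sub>q[T]\<close>, the ideal exists
  and does not depend on the decomposition; for other modules the value may be unspecified.
\<close>

definition euler_poincare :: "('a, 'm) ring_scheme \<Rightarrow> ('a, 'b) module \<Rightarrow> 'a set"
  where "euler_poincare R N = (THE I. \<exists>Js.
    (\<forall>J \<in> set Js. ideal J R \<and> J \<noteq> {\<zero>\<^bsub>R\<^esub>}) \<and>
    modules_isomorphic R N (direct_sum (map (quotient_module R) Js)) \<and>
    I = foldr (ideal_prod R) Js (carrier R))"

text \<open>
  The element \<open>\<Sum>i. c\<^sub>i \<tau>\<^sup>i\<close> of \<open>L{\<tau>}\<close> is represented by the ordinary polynomial with
  the same coefficients. Addition is coefficientwise, and the product is determined by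
  \<open>(a \<tau>\<^sup>i) (b \<tau>\<^sup>j) = a b^(q^i) \<tau>^(i+j)\<close>; the product \<open>*\<close> of the type class is not used.
\<close>

definition ore_mult :: "nat \<Rightarrow> 'l::comm_ring_1 poly \<Rightarrow> 'l poly \<Rightarrow> 'l poly"
  where "ore_mult q f g =
    (\<Sum>i\<le>Polynomial.degree f. \<Sum>j\<le>Polynomial.degree g.
      Polynomial.monom (Polynomial.coeff f i * Polynomial.coeff g j ^ (q ^ i)) (i + j))"

definition ore_ring :: "nat \<Rightarrow> 'l::comm_ring_1 poly ring"
  where "ore_ring q =
    \<lparr>carrier = UNIV, monoid.mult = ore_mult q, one = 1, ring.zero = 0, add = (+)\<rparr>"

definition ore_apply :: "nat \<Rightarrow> 'l::comm_ring_1 poly \<Rightarrow> 'l \<Rightarrow> 'l"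
  where "ore_apply q f x = (\<Sum>i\<le>Polynomial.degree f. Polynomial.coeff f i * x ^ (q ^ i))"

text \<open>
  The type \<open>'k\<close> is \<open>F\<^sub>q\<close>, with \<open>q = CARD('k)\<close>, the type \<open>'k poly\<close> is \<open>A\<close>, and \<open>'l\<close> is \<open>L\<close>.
  The map \<open>\<iota>\<close> is the inclusion of \<open>F\<^sub>q\<close> in \<open>L\<close>. The structure maps of the \<open>F\<^sub>q\<close>-algebras \<open>A\<close> and
  \<open>L{\<tau>}\<close> are \<open>c \<mapsto> [:c:]\<close> and \<open>c \<mapsto> [:\<iota> c:]\<close>.
\<close>

abbreviation A_ring :: "'k::Fields.field poly ring"
  where "A_ring \<equiv> ring_of_type_algebra"

locale finite_A_field =
  fixes \<iota> :: "'k::{Fields.field, finite} \<Rightarrow> 'l::{Fields.field, finite}"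
    and \<gamma> :: "'k poly \<Rightarrow> 'l"
  assumes iota_hom: "\<iota> \<in> ring_hom ring_of_type_algebra ring_of_type_algebra"
    and gamma_hom: "\<gamma> \<in> ring_hom A_ring ring_of_type_algebra"
    and gamma_const: "\<gamma> [:c:] = \<iota> c"

locale drinfeld_module_rank2 = finite_A_field \<iota> \<gamma>
  for \<iota> :: "'k::{Fields.field, finite} \<Rightarrow> 'l::{Fields.field, finite}"
    and \<gamma> :: "'k poly \<Rightarrow> 'l" +
  fixes \<Phi> :: "'k poly \<Rightarrow> 'l poly"
  assumes Phi_hom: "\<Phi> \<in> ring_hom A_ring (ore_ring CARD('k))"
    and Phi_const: "\<Phi> [:c:] = [:\<iota> c:]"
    and Phi_T: "\<exists>a\<^sub>2 a\<^sub>3. a\<^sub>3 \<noteq> 0 \<and> \<Phi> [:0, 1:] = [:\<gamma> [:0, 1:], a\<^sub>2, a\<^sub>3:]"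

text \<open>
  This is the \<open>A\<close>-module \<open>L\<^sup>\<Phi>\<close>: the additive group of \<open>L\<close> with \<open>a \<cdot> x = \<Phi>\<^sub>a(x)\<close>.
\<close>

definition drinfeld_point_module ::
    "('k::{Fields.field, finite} poly \<Rightarrow> 'l::{Fields.field, finite} poly) \<Rightarrow> ('k poly, 'l) module"
  where "drinfeld_point_module \<Phi> =
    ring.extend ring_of_type_algebra (module.fields (\<lambda>a x. ore_apply CARD('k) (\<Phi> a) x))"

end

theory Submission
  imports Defs
begin

text \<open>
  The module \<open>L\<^sup>\<Phi>\<close> is finite, and for nonzero \<open>a\<close> its \<open>a\<close>-torsion is small: \<open>\<Phi>\<^sub>a\<close> is an Ore polynomial of degree
  \<open>2 deg a\<close> (\<open>degree_Phi\<close>), so it acts on \<open>L\<close> as an ordinary polynomial of degree \<open>q^(2 deg a)\<close>, which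
  has at most that many zeros (\<open>card_ore_kernel\<close>). Thus the torsion is never larger than that of a
  module \<open>(A/a)\<^sup>2\<close>, and this bound alone limits the number of cyclic summands to two
  (\<open>two_cyclic_summands\<close>). One splits off a cyclic summand of the largest possible order, the exponent
  of the module, which has a complement (\<open>exponent_element\<close>, \<open>cyclic_complement\<close>); then the torsion
  bound, applied to the exponent of the complement, forces the complement to be cyclic.

  The value of the characteristic is then \<open>I\<^sub>1 I\<^sub>2\<close>, provided that it does not depend on the
  decomposition (\<open>euler_poincare_eq\<close>). For an irreducible \<open>p\<close> and large \<open>n\<close>, the number of elements
  of \<open>A/J\<^sub>1 \<oplus> \<dots> \<oplus> A/J\<^sub>r\<close> killed by \<open>p\<^sup>n\<close> is \<open>q^(v deg p)\<close>, where \<open>v\<close> is the \<open>p\<close>-adic valuation of a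
  generator of \<open>J\<^sub>1 \<cdots> J\<^sub>r\<close> (\<open>card_torsion_cyclic_sum\<close>). So the module determines all the valuations
  of that generator, hence the product ideal.
\<close>

section \<open>Divisibility of polynomials over a field\<close>

text \<open>
  A nonzero element of minimal degree generates, since otherwise a remainder would have smaller
  degree. The closure conditions on a bare set serve for the ideals of the ring \<open>k[T]\<close> and for
  the annihilators, conductors and Bezout combinations below alike.
\<close>

lemma poly_ideal_principal:
  fixes S :: "'a::Fields.field poly set"
  assumes "0 \<in> S" and add: "\<And>a b. a \<in> S \<Longrightarrow> b \<in> S \<Longrightarrow> a + b \<in> S"
    and mult: "\<And>a b. b \<in> S \<Longrightarrow> a * b \<in> S"
  obtains d where "S = {a. d dvd a}"
proof (cases "S = {0}")
  case True
  then have "S = {a. 0 dvd a}" by auto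
  then show ?thesis by (rule that)
next
  case False
  with assms(1) have "\<exists>d. d \<in> S \<and> d \<noteq> 0" by auto
  then obtain d where d: "d \<in> S" "d \<noteq> 0"
    and min: "\<And>b. b \<in> S \<Longrightarrow> b \<noteq> 0 \<Longrightarrow> Polynomial.degree d \<le> Polynomial.degree b"
    using ex_has_least_nat[of "\<lambda>d. d \<in> S \<and> d \<noteq> 0" _ Polynomial.degree] by metis
  have "d dvd a" if "a \<in> S" for a
  proof -
    have "a mod d = a + (- (a div d)) * d"
      by (simp add: minus_div_mult_eq_mod [symmetric])
    then have "a mod d \<in> S" using add mult d(1) that by metis
    then have "a mod d = 0" using min degree_mod_less' d(2) by (meson not_le)
    then show ?thesis by (simp add: mod_eq_0_iff_dvd)
  qed
  moreover have "a \<in> S" if "d dvd a" for a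
    using that mult d(1) by (metis dvdE mult.commute)
  ultimately have "S = {a. d dvd a}" by auto
  then show ?thesis by (rule that)
qed

lemma poly_bezout:
  fixes a b :: "'a::Fields.field poly"
  obtains d u v where "d dvd a" "d dvd b" "d = u * a + v * b"
proof -
  define S where "S = {u * a + v * b | u v. True}"
  have "0 \<in> S" unfolding S_def by (rule CollectI, intro exI[of _ 0]) simp
  moreover have "x + y \<in> S" if "x \<in> S" "y \<in> S" for x y
  proof -
    obtain u v where "x = u * a + v * b" using \<open>x \<in> S\<close> unfolding S_def by blast
    moreover obtain u' v' where "y = u' * a + v' * b" using \<open>y \<in> S\<close> unfolding S_def by blast
    ultimately have "x + y = (u + u') * a + (v + v') * b" by (simp add: algebra_simps)
    then show ?thesis unfolding S_def by blast
  qed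
  moreover have "x * y \<in> S" if "y \<in> S" for x y
  proof -
    obtain u v where "y = u * a + v * b" using \<open>y \<in> S\<close> unfolding S_def by blast
    then have "x * y = (x * u) * a + (x * v) * b" by (simp add: algebra_simps)
    then show ?thesis unfolding S_def by blast
  qed
  ultimately obtain d where d: "S = {x. d dvd x}" using poly_ideal_principal by metis
  have "a = 1 * a + 0 * b" "b = 0 * a + 1 * b" by simp_all
  then have "a \<in> S" "b \<in> S" unfolding S_def by blast+
  moreover have "d \<in> S" by (simp add: d)
  ultimately show ?thesis using that d unfolding S_def by blast
qed

text \<open>
  Some common divisor of \<open>a\<close> and \<open>b\<close> is a combination of them, so coprimality becomes an equation; the
  multiplicative properties of coprime polynomials then follow by calculation.
\<close>

lemma poly_coprime_iff_bezout:
  fixes a b :: "'a::Fields.field poly"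
  shows "coprime a b \<longleftrightarrow> (\<exists>u v. u * a + v * b = 1)"
proof
  assume cop: "coprime a b"
  obtain d u v where "d dvd a" "d dvd b" and d: "d = u * a + v * b" by (rule poly_bezout)
  with cop have "is_unit d" by (auto elim: coprime_common_divisor)
  then obtain c where "1 = d * c" by (auto elim: dvdE)
  with d have "(c * u) * a + (c * v) * b = 1" by (simp add: algebra_simps)
  then show "\<exists>u v. u * a + v * b = 1" by blast
next
  assume "\<exists>u v. u * a + v * b = 1"
  then show "coprime a b"
    by (metis coprimeI dvd_add dvd_mult)
qed

lemma poly_coprime_mult_left:
  fixes a b c :: "'a::Fields.field poly"
  assumes "coprime a c" "coprime b c"
  shows "coprime (a * b) c"
proof -
  obtain u v u' v' where 1: "u * a + v * c = 1" and 2: "u' * b + v' * c = 1"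
    using assms unfolding poly_coprime_iff_bezout by blast
  have "(u * u') * (a * b) + (u * a * v' + v * (u' * b) + v * v' * c) * c
      = (u * a + v * c) * (u' * b + v' * c)"
    by (simp add: algebra_simps)
  then show ?thesis unfolding poly_coprime_iff_bezout 1 2 by (metis mult_1)
qed

lemma poly_coprime_power_left:
  fixes a c :: "'a::Fields.field poly"
  assumes "coprime a c"
  shows "coprime (a ^ n) c"
  by (induction n) (simp_all add: assms poly_coprime_mult_left)

lemma poly_coprime_dvd_mult:
  fixes a b c :: "'a::Fields.field poly"
  assumes "coprime a c" "a dvd c * b"
  shows "a dvd b"
proof -
  obtain u v where "u * a + v * c = 1"
    using assms(1) unfolding poly_coprime_iff_bezout by blast
  then have "b = (u * b) * a + v * (c * b)"
    by (metis (no_types, opaque_lifting) distrib_right mult.assoc mult.commute mult_1)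
  then show ?thesis using assms(2) by (metis dvd_add dvd_mult dvd_triv_right)
qed

lemma poly_coprime_mult_dvd:
  fixes a b c :: "'a::Fields.field poly"
  assumes "coprime a b" "a dvd c" "b dvd c"
  shows "a * b dvd c"
  using assms poly_coprime_dvd_mult[of b a] coprime_commute
  by (metis dvdE mult_dvd_mono dvd_refl)

lemma poly_irreducible_coprime:
  fixes p a :: "'a::Fields.field poly"
  assumes "Factorial_Ring.irreducible p" "\<not> p dvd a"
  shows "coprime p a"
proof (rule coprimeI)
  fix d assume d: "d dvd p" "d dvd a"
  show "is_unit d"
    using assms d irreducibleD' by (metis dvd_trans)
qed

lemma poly_irreducible_degree_pos:
  fixes p :: "'a::Fields.field poly"
  assumes "Factorial_Ring.irreducible p"
  shows "0 < Polynomial.degree p"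
  using assms by (metis Factorial_Ring.irreducible_def bot_nat_0.not_eq_extremum is_unit_iff_degree)

lemma poly_irreducible_divisor:
  fixes a :: "'a::Fields.field poly"
  assumes "a \<noteq> 0" "\<not> is_unit a"
  obtains p where "Factorial_Ring.irreducible p" "p dvd a"
proof -
  have "\<exists>p. Factorial_Ring.irreducible p \<and> p dvd a"
    using assms
  proof (induction "Polynomial.degree a" arbitrary: a rule: less_induct)
    case less
    show ?case
    proof (cases "Factorial_Ring.irreducible a")
      case False
      then obtain b c where bc: "a = b * c" "\<not> is_unit b" "\<not> is_unit c"
        using less.prems by (auto simp: Factorial_Ring.irreducible_def)
      then have nz: "b \<noteq> 0" "c \<noteq> 0" using less.prems by auto
      then have "Polynomial.degree c > 0" using bc(3) is_unit_iff_degree by blast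
      then have "Polynomial.degree b < Polynomial.degree a"
        using bc(1) nz by (simp add: degree_mult_eq)
      then show ?thesis using less.hyps nz bc by (metis dvd_mult2)
    qed auto
  qed
  then show ?thesis using that by blast
qed

text \<open>
  Dividing out \<open>p\<close> lowers the degree, so this stops. It makes the \<open>p\<close>-adic valuation \<open>n\<close> of
  \<open>a\<close> available.
\<close>

lemma poly_split_power:
  fixes p a :: "'a::Fields.field poly"
  assumes p: "Factorial_Ring.irreducible p" and "a \<noteq> 0"
  obtains n u where "a = p ^ n * u" "\<not> p dvd u" "u \<noteq> 0"
proof -
  have "\<exists>n u. a = p ^ n * u \<and> \<not> p dvd u"
    using assms(2)
  proof (induction "Polynomial.degree a" arbitrary: a rule: less_induct)
    case less
    show ?case
    proof (cases "p dvd a")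
      case True
      then obtain b where b: "a = p * b" by (auto elim: dvdE)
      then have "Polynomial.degree b < Polynomial.degree a" "b \<noteq> 0"
        using less.prems poly_irreducible_degree_pos[OF p] by (auto simp: degree_mult_eq)
      then obtain n u where "b = p ^ n * u" "\<not> p dvd u" using less.hyps by blast
      then have "a = p ^ Suc n * u" "\<not> p dvd u" using b by simp_all
      then show ?thesis by blast
    next
      case False
      then have "a = p ^ 0 * a" by simp
      with False show ?thesis by blast
    qed
  qed
  then show ?thesis using that assms(2) by fastforce
qed

lemma poly_power_dvd_split_iff:
  fixes p u :: "'a::Fields.field poly"
  assumes p: "Factorial_Ring.irreducible p" and u: "\<not> p dvd u"
  shows "p ^ k dvd p ^ n * u \<longleftrightarrow> k \<le> n"
proof
  assume dv: "p ^ k dvd p ^ n * u"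
  show "k \<le> n"
  proof (rule ccontr)
    assume "\<not> k \<le> n"
    then have "p ^ n * p dvd p ^ k"
      by (metis le_imp_power_dvd not_less_eq_eq power_Suc2)
    with dv have "p ^ n * p dvd p ^ n * u" by (rule dvd_trans[rotated])
    moreover have "p ^ n \<noteq> 0" using p by auto
    ultimately have "p dvd u" by (simp only: dvd_mult_cancel_left) simp
    with u show False ..
  qed
qed (simp add: le_imp_power_dvd)

text \<open>
  Local-to-global principle for divisibility. With \<open>b = g * c\<close> for the greatest common divisor
  \<open>g\<close> of \<open>a\<close> and \<open>b\<close>, any irreducible \<open>p\<close> dividing the nonunit \<open>c\<close> works: if the full \<open>p\<close>-part of
  \<open>b\<close> divided \<open>a\<close>, it would divide \<open>g\<close>, and \<open>c\<close> would contribute one more factor \<open>p\<close>.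
\<close>

lemma poly_not_dvd_prime_power:
  fixes a b :: "'a::Fields.field poly"
  assumes "b \<noteq> 0" "\<not> b dvd a"
  obtains p n where "Factorial_Ring.irreducible p" "p ^ n dvd b" "\<not> p ^ n dvd a"
proof -
  obtain g u v where g: "g dvd a" "g dvd b" "g = u * a + v * b" by (rule poly_bezout)
  obtain c where c: "b = g * c" using g(2) by (auto elim: dvdE)
  have "\<not> is_unit c" using c g(1) assms(2) by (metis mult_unit_dvd_iff)
  moreover have "c \<noteq> 0" using c assms(1) by auto
  ultimately obtain p where p: "Factorial_Ring.irreducible p" "p dvd c"
    using poly_irreducible_divisor by blast
  obtain n w where w: "b = p ^ n * w" "\<not> p dvd w" using poly_split_power[OF p(1) assms(1)] by metis
  have "\<not> p ^ n dvd a"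
  proof
    assume "p ^ n dvd a"
    then have "p ^ n dvd g" using g(3) w(1) by (simp add: dvd_add)
    then have "p ^ Suc n dvd b" using p(2) c by (simp add: mult_dvd_mono power_Suc2 del: power_Suc)
    then show False unfolding w(1) poly_power_dvd_split_iff[OF p(1) w(2)] by simp
  qed
  then show ?thesis using that p(1) w(1) by (metis dvd_triv_left)
qed

text \<open>
  The standard representatives of the residue classes modulo a polynomial of degree \<open>n\<close>. For
  \<open>n = 0\<close> the zero polynomial is the only one, which a bound on the degree alone would not say.
\<close>

definition polys_below :: "nat \<Rightarrow> 'a::zero poly set"
  where "polys_below n = {r. \<forall>i\<ge>n. Polynomial.coeff r i = 0}"

lemma polys_below_iff: "r \<in> polys_below n \<longleftrightarrow> r = 0 \<or> Polynomial.degree r < n"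
  unfolding polys_below_def
  by (auto simp: coeff_eq_0) (metis leading_coeff_0_iff not_le)

lemma diff_in_polys_below:
  fixes r s :: "'a::ab_group_add poly"
  shows "r \<in> polys_below n \<Longrightarrow> s \<in> polys_below n \<Longrightarrow> r - s \<in> polys_below n"
  by (simp add: polys_below_def)

lemma card_polys_below:
  "finite (polys_below n :: 'a::{zero, finite} poly set) \<and>
    card (polys_below n :: 'a poly set) = CARD('a) ^ n"
proof (induction n)
  case 0
  have "polys_below 0 = {0 :: 'a poly}" by (auto simp: polys_below_def poly_eq_iff)
  then show ?case by simp
next
  case (Suc n)
  have "polys_below (Suc n) = (\<lambda>(c, r). pCons c r) ` (UNIV \<times> (polys_below n :: 'a poly set))"
  proof (intro subset_antisym subsetI)
    fix r :: "'a poly" assume r: "r \<in> polys_below (Suc n)"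
    obtain c s where cs: "r = pCons c s" by (cases r)
    have "Polynomial.coeff s i = 0" if "n \<le> i" for i
      using r that unfolding cs polys_below_def by (metis (mono_tags) Suc_le_mono coeff_pCons_Suc mem_Collect_eq)
    then show "r \<in> (\<lambda>(c, r). pCons c r) ` (UNIV \<times> polys_below n)"
      using cs by (auto simp: polys_below_def)
  next
    fix r :: "'a poly" assume "r \<in> (\<lambda>(c, r). pCons c r) ` (UNIV \<times> polys_below n)"
    then show "r \<in> polys_below (Suc n)"
      by (auto simp: polys_below_def coeff_pCons split: nat.split)
  qed
  moreover have "inj_on (\<lambda>(c, r). pCons c r) (UNIV \<times> (polys_below n :: 'a poly set))"
    by (auto simp: inj_on_def)
  ultimately show ?case using Suc by (simp add: card_image card_cartesian_product)
qed

lemma two_le_card_field: "2 \<le> CARD('k::{Fields.field, finite})"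
proof -
  have "card {0, 1 :: 'k} \<le> CARD('k)" by (rule card_mono) simp_all
  then show ?thesis by simp
qed

lemma dvd_in_polys_below_zero:
  fixes r d :: "'a::Fields.field poly"
  assumes "d dvd r" "r \<in> polys_below (Polynomial.degree d)"
  shows "r = 0"
  using assms polys_below_iff by (metis dvd_imp_degree_le not_le)

lemma mod_in_polys_below:
  fixes r d :: "'a::Fields.field poly"
  assumes "d \<noteq> 0"
  shows "r mod d \<in> polys_below (Polynomial.degree d)"
  using degree_mod_less[OF assms, of r] by (auto simp: polys_below_iff)

section \<open>Finite modules over a polynomial ring\<close>

text \<open>
  The underlying group is a whole type and not a carrier set, so that the notions of subspace and
  span of the class-based modules apply.
\<close>

locale finite_poly_module = Modules.module scale
  for scale :: "'k::{Fields.field, finite} poly \<Rightarrow> 'b::{ab_group_add, finite} \<Rightarrow> 'b"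
    (infixr "*s" 75)
begin

text \<open>
  The order of \<open>x\<close> is a generator of its annihilator, so it is determined up to a unit.
\<close>

definition has_order :: "'b \<Rightarrow> 'k poly \<Rightarrow> bool"
  where "has_order x m \<longleftrightarrow> m \<noteq> 0 \<and> (\<forall>a. a *s x = 0 \<longleftrightarrow> m dvd a)"

lemma has_order_nonzero: "has_order x m \<Longrightarrow> m \<noteq> 0"
  and has_order_iff: "has_order x m \<Longrightarrow> a *s x = 0 \<longleftrightarrow> m dvd a"
  by (simp_all add: has_order_def)

lemma has_order_eq_iff: "has_order x m \<Longrightarrow> a *s x = b *s x \<longleftrightarrow> m dvd a - b"
  by (metis eq_iff_diff_eq_0 has_order_iff scale_left_diff_distrib)

lemma ex_has_order: "\<exists>m. has_order x m"
proof -
  define S where "S = {a. a *s x = 0}"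
  have "0 \<in> S" by (simp add: S_def)
  moreover have "a + b \<in> S" if "a \<in> S" "b \<in> S" for a b
    using that by (simp add: S_def scale_left_distrib)
  moreover have "a * b \<in> S" if "b \<in> S" for a b
    using that by (simp add: S_def flip: scale_scale)
  ultimately obtain m where m: "S = {a. m dvd a}" using poly_ideal_principal by metis
  \<comment> \<open>By the pigeonhole principle two of the powers of \<open>T\<close> act in the same way on \<open>x\<close>.\<close>
  have "\<not> inj (\<lambda>n. Polynomial.monom 1 n *s x)"
    using finite_imageD[of "\<lambda>n. Polynomial.monom 1 n *s x" "UNIV :: nat set"] by auto
  then obtain i j where ij: "Polynomial.monom 1 i *s x = Polynomial.monom 1 j *s x" "i \<noteq> j"
    unfolding inj_def by blast
  then have "Polynomial.monom 1 i - Polynomial.monom 1 j \<in> S"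
    by (simp add: S_def scale_left_diff_distrib)
  moreover have "Polynomial.monom (1::'k) i - Polynomial.monom 1 j \<noteq> 0"
    using ij(2) by (simp add: monom_eq_iff')
  ultimately have "m \<noteq> 0" using m by auto
  then show ?thesis using m by (auto simp: has_order_def S_def)
qed

lemma card_cyclic:
  assumes "has_order x m"
  shows "card (span {x}) = CARD('k) ^ Polynomial.degree m"
proof -
  have "bij_betw (\<lambda>a. a *s x) (polys_below (Polynomial.degree m)) (span {x})"
    unfolding bij_betw_def
  proof
    show "inj_on (\<lambda>a. a *s x) (polys_below (Polynomial.degree m))"
    proof (rule inj_onI)
      fix a b assume ab: "a \<in> polys_below (Polynomial.degree m)"
        "b \<in> polys_below (Polynomial.degree m)" "a *s x = b *s x"
      then have "a - b = 0"
        using dvd_in_polys_below_zero diff_in_polys_below has_order_eq_iff[OF assms] by metis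
      then show "a = b" by simp
    qed
    have "a *s x \<in> (\<lambda>a. a *s x) ` polys_below (Polynomial.degree m)" for a
    proof
      show "a *s x = (a mod m) *s x"
        by (simp add: has_order_eq_iff[OF assms] minus_mod_eq_mult_div)
    qed (rule mod_in_polys_below[OF has_order_nonzero[OF assms]])
    then show "(\<lambda>a. a *s x) ` polys_below (Polynomial.degree m) = span {x}"
      unfolding span_singleton by blast
  qed
  then show ?thesis using card_polys_below bij_betw_same_card by metis
qed

lemma has_order_scale:
  assumes "has_order x (a * b)"
  shows "has_order (a *s x) b"
  using assms unfolding has_order_def scale_scale
  by (metis dvd_mult_cancel_right mult.commute mult_eq_0_iff)

lemma has_order_add:
  assumes x: "has_order x a" and y: "has_order y b" and cop: "coprime a b"
  shows "has_order (x + y) (a * b)"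
  unfolding has_order_def
proof (intro conjI allI iffI)
  show "a * b \<noteq> 0" using x y by (simp add: has_order_nonzero)
  fix c
  show "c *s (x + y) = 0" if "a * b dvd c"
    using that x y dvd_mult_left dvd_mult_right by (metis add.right_neutral has_order_iff scale_right_distrib)
  assume "c *s (x + y) = 0"
  then have sum: "c *s x + c *s y = 0" by (simp add: scale_right_distrib)
  \<comment> \<open>Multiplying by \<open>b\<close> kills the second summand, and \<open>b\<close> is invertible modulo \<open>a\<close>.\<close>
  have "b *s c *s y = 0" "a *s c *s x = 0"
    using x y by (simp_all add: has_order_iff)
  then have "(b * c) *s x = 0" "(a * c) *s y = 0"
    using arg_cong[OF sum, of "\<lambda>z. b *s z"] arg_cong[OF sum, of "\<lambda>z. a *s z"]
    by (simp_all add: scale_right_distrib)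
  then have "a dvd c" "b dvd c"
    using x y cop by (metis coprime_commute has_order_iff poly_coprime_dvd_mult)+
  then show "a * b dvd c" using cop poly_coprime_mult_dvd by blast
qed

text \<open>
  An element whose order has maximal degree will do: if the order of some \<open>y\<close> in \<open>S\<close> did not
  divide it, then a combination with \<open>y\<close> would have an order of larger degree. So \<open>m\<close> is the exponent
  of \<open>S\<close>.
\<close>

lemma exponent_element:
  assumes S: "subspace S"
  obtains x m where "x \<in> S" "has_order x m" "\<And>y. y \<in> S \<Longrightarrow> m *s y = 0"
proof -
  have bounded: "Polynomial.degree m < Suc CARD('b)" if "has_order x m" for x m
  proof -
    have "Polynomial.degree m < 2 ^ Polynomial.degree m" by (rule less_exp)
    also have "\<dots> \<le> CARD('k) ^ Polynomial.degree m"
      by (rule power_mono[OF two_le_card_field]) simp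
    also have "\<dots> \<le> CARD('b)"
      unfolding card_cyclic[OF that, symmetric] by (rule card_mono) simp_all
    finally show ?thesis by simp
  qed
  obtain m\<^sub>0 where "has_order 0 m\<^sub>0" using ex_has_order by blast
  then have "\<exists>m. (\<exists>x\<in>S. has_order x m) \<and>
      (\<forall>m'. (\<exists>x\<in>S. has_order x m') \<longrightarrow> Polynomial.degree m' \<le> Polynomial.degree m)"
    using ex_has_greatest_nat[of "\<lambda>m. \<exists>x\<in>S. has_order x m" m\<^sub>0 Polynomial.degree "Suc CARD('b)"]
      bounded subspace_0[OF S] by blast
  then obtain x m where x: "x \<in> S" "has_order x m"
    and max: "\<And>x' m'. x' \<in> S \<Longrightarrow> has_order x' m' \<Longrightarrow> Polynomial.degree m' \<le> Polynomial.degree m"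
    by blast
  have "m *s y = 0" if y: "y \<in> S" for y
  proof (rule ccontr)
    assume nz: "m *s y \<noteq> 0"
    obtain b where b: "has_order y b" using ex_has_order by blast
    with nz have "\<not> b dvd m" by (simp add: has_order_iff)
    then obtain p k where p: "Factorial_Ring.irreducible p" and k: "p ^ k dvd b" "\<not> p ^ k dvd m"
      using poly_not_dvd_prime_power has_order_nonzero[OF b] by blast
    obtain b' where b': "b = b' * p ^ k" using k(1) by (metis dvdE mult.commute)
    obtain n u where u: "m = p ^ n * u" "\<not> p dvd u" "u \<noteq> 0"
      using poly_split_power[OF p has_order_nonzero[OF x(2)]] by blast
    \<comment> \<open>Since \<open>n < k\<close>, replacing the \<open>p\<close>-part of \<open>x\<close> by that of \<open>y\<close> gives an element of
      \<open>S\<close> whose order has larger degree than \<open>m\<close>.\<close>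
    have "n < k" using k(2) poly_power_dvd_split_iff[OF p u(2)] u(1) by simp
    have "has_order (p ^ n *s x + b' *s y) (u * p ^ k)"
    proof (rule has_order_add)
      show "has_order (p ^ n *s x) u" using x(2) u(1) has_order_scale by metis
      show "has_order (b' *s y) (p ^ k)" using b b' has_order_scale by metis
      show "coprime u (p ^ k)"
        using poly_coprime_power_left[OF poly_irreducible_coprime[OF p u(2)]]
        by (simp add: coprime_commute)
    qed
    moreover have "p ^ n *s x + b' *s y \<in> S"
      using S x(1) y by (simp add: subspace_add subspace_scale)
    ultimately have "Polynomial.degree (u * p ^ k) \<le> Polynomial.degree m" using max by blast
    moreover have "p \<noteq> 0" using p by auto
    ultimately show False
      using u \<open>n < k\<close> poly_irreducible_degree_pos[OF p]
      by (simp add: degree_mult_eq degree_power_eq)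
  qed
  then show ?thesis using that x by blast
qed

text \<open>
  A cyclic submodule whose order is the exponent of the module is a direct summand. The proof
  takes a submodule \<open>N\<close> of maximal size among those meeting it trivially and shows that it is a
  complement. For any \<open>z\<close>, the polynomials \<open>b\<close> which carry \<open>z\<close> into the sum of \<open>N\<close> and the
  multiples of \<open>x\<close> form an ideal; because \<open>m\<close> kills \<open>z\<close>, its generator \<open>d\<close> divides \<open>m\<close>, and the
  component of \<open>d *s z\<close> along \<open>x\<close> is itself divisible by \<open>d\<close>.
\<close>

lemma cyclic_complement:
  assumes x: "has_order x m" and exponent: "\<And>y. m *s y = 0"
  obtains N where "subspace N" "span {x} \<inter> N = {0}" "\<And>z. \<exists>a. z - a *s x \<in> N"
proof -
  define P where "P N \<longleftrightarrow> subspace N \<and> span {x} \<inter> N = {0}" for N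
  have "P {0}" by (auto simp: P_def span_zero)
  then have "\<exists>N. P N \<and> (\<forall>M. P M \<longrightarrow> card M \<le> card N)"
    using ex_has_greatest_nat[of P "{0}" card "Suc CARD('b)"]
    by (meson card_mono finite less_Suc_eq_le subset_UNIV)
  then obtain N where "P N" and max: "\<And>M. P M \<Longrightarrow> card M \<le> card N"
    by blast
  then have N: "subspace N" "span {x} \<inter> N = {0}" by (simp_all add: P_def)
  have inter: "c *s x = 0" if "c *s x \<in> N" for c
    using N(2) that span_base span_scale by blast
  have "\<exists>a. z - a *s x \<in> N" for z
  proof -
    define S where "S = {b. \<exists>a. b *s z - a *s x \<in> N}"
    have "0 \<in> S" unfolding S_def using subspace_0[OF N(1)] by (auto intro: exI[of _ 0])
    moreover have "b + b' \<in> S" if "b \<in> S" "b' \<in> S" for b b'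
    proof -
      obtain a where "b *s z - a *s x \<in> N" using \<open>b \<in> S\<close> unfolding S_def by blast
      moreover obtain a' where "b' *s z - a' *s x \<in> N" using \<open>b' \<in> S\<close> unfolding S_def by blast
      ultimately have "(b *s z - a *s x) + (b' *s z - a' *s x) \<in> N"
        by (rule subspace_add[OF N(1)])
      then have "(b + b') *s z - (a + a') *s x \<in> N"
        by (simp add: scale_left_distrib algebra_simps)
      then show ?thesis unfolding S_def by blast
    qed
    moreover have "c * b \<in> S" if "b \<in> S" for b c
    proof -
      obtain a where "b *s z - a *s x \<in> N" using \<open>b \<in> S\<close> unfolding S_def by blast
      then have "c *s (b *s z - a *s x) \<in> N" by (rule subspace_scale[OF N(1)])
      then have "(c * b) *s z - (c * a) *s x \<in> N" by (simp add: scale_right_diff_distrib)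
      then show ?thesis unfolding S_def by blast
    qed
    ultimately obtain d where d: "S = {b. d dvd b}" using poly_ideal_principal by metis
    have "m *s z - 0 *s x \<in> N" using exponent subspace_0[OF N(1)] by simp
    then have "m \<in> S" unfolding S_def by blast
    then obtain e where e: "m = e * d" using d by (metis dvdE mem_Collect_eq mult.commute)
    have "d \<in> S" using d by simp
    then obtain a where a: "d *s z - a *s x \<in> N" unfolding S_def by blast
    then have "e *s (d *s z - a *s x) \<in> N" by (rule subspace_scale[OF N(1)])
    then have "- ((e * a) *s x) \<in> N"
      using exponent[of z] by (simp add: scale_right_diff_distrib e)
    then have "(e * a) *s x = 0" using inter subspace_neg[OF N(1)] by fastforce
    then have "e * d dvd e * a" using x e by (simp add: has_order_iff)
    moreover have "e \<noteq> 0" using e has_order_nonzero[OF x] by auto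
    ultimately have "d dvd a" by simp
    then obtain a' where a': "a = d * a'" by (auto elim: dvdE)
    \<comment> \<open>Correcting \<open>z\<close> by a multiple of \<open>x\<close> gives an element which can be added to \<open>N\<close> without
      creating an intersection with the multiples of \<open>x\<close>.\<close>
    define z' where "z' = z - a' *s x"
    have dz: "d *s z' \<in> N" using a by (simp add: z'_def a' scale_right_diff_distrib)
    have "P (span (insert z' N))"
      unfolding P_def
    proof
      have "w = 0" if w: "w \<in> span {x}" "w \<in> span (insert z' N)" for w
      proof -
        obtain b where b: "w - b *s z' \<in> N"
          using w(2) unfolding span_insert span_eq_iff[THEN iffD2, OF N(1)] by blast
        obtain c where c: "w = c *s x" using w(1) unfolding span_singleton by blast
        have "b *s z - (b * a' + c) *s x = - (w - b *s z')"
          by (simp add: z'_def c scale_right_diff_distrib scale_left_distrib algebra_simps)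
        then have "b *s z - (b * a' + c) *s x \<in> N" using subspace_neg[OF N(1) b] by simp
        then have "b \<in> S" unfolding S_def by blast
        then obtain b' where "b = b' * d" using d by (metis dvdE mem_Collect_eq mult.commute)
        then have "b *s z' \<in> N" using subspace_scale[OF N(1) dz] by (metis scale_scale)
        then have "w \<in> N" using subspace_add[OF N(1) b, of "b *s z'"] by simp
        then show "w = 0" using inter c by blast
      qed
      then show "span {x} \<inter> span (insert z' N) = {0}" using span_zero by blast
    qed simp
    then have "card (span (insert z' N)) \<le> card N" by (rule max)
    moreover have "N \<subseteq> span (insert z' N)" using span_superset by blast
    ultimately have "N = span (insert z' N)" by (meson card_seteq finite)
    then have "z' \<in> N" using span_base by (metis insertI1)
    then show "\<exists>a. z - a *s x \<in> N" unfolding z'_def by blast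
  qed
  then show ?thesis using that N by blast
qed

text \<open>
  The analogue of the fact that a finite group with at most \<open>n\<close> solutions of \<open>x^n = 1\<close> for all
  \<open>n\<close> is cyclic, in rank two. Split off a cyclic summand generated by an \<open>x\<close> whose order is the
  exponent. The exponent \<open>n\<close> of the complement \<open>N\<close> divides the exponent of the module, so the first
  summand already contains
  \<open>q^(deg n)\<close> elements killed by \<open>n\<close>. The bound leaves room for at most \<open>q^(deg n)\<close> elements of
  \<open>N\<close>, which is the size of a cyclic submodule of \<open>N\<close> of order \<open>n\<close>.
\<close>

lemma two_cyclic_summands:
  assumes torsion: "\<And>f. f \<noteq> 0 \<Longrightarrow> card {z. f *s z = 0} \<le> CARD('k) ^ (2 * Polynomial.degree f)"
  obtains x y m n where "has_order x m" "has_order y n" "span {x} \<inter> span {y} = {0}"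
    "\<And>z. \<exists>a b. z = a *s x + b *s y"
proof -
  obtain x m where x: "has_order x m" and m: "\<And>z. m *s z = 0"
    using exponent_element[OF subspace_UNIV] by (metis UNIV_I)
  obtain N where N: "subspace N" "span {x} \<inter> N = {0}" and split: "\<And>z. \<exists>a. z - a *s x \<in> N"
    using cyclic_complement[OF x m] by metis
  obtain y n where y: "y \<in> N" "has_order y n" and n: "\<And>z. z \<in> N \<Longrightarrow> n *s z = 0"
    using exponent_element[OF N(1)] by metis
  have yN: "span {y} \<subseteq> N" using y(1) N(1) by (simp add: span_minimal)
  obtain l where l: "m = l * n"
    using m[of y] y(2) by (metis dvdE has_order_iff mult.commute)
  have ordl: "has_order (l *s x) n" using x l has_order_scale by metis
  have lx: "span {l *s x} \<subseteq> span {x}" by (simp add: span_minimal span_base span_scale)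
  \<comment> \<open>The \<open>n\<close>-torsion contains the direct sum of \<open>N\<close> and of the submodule generated by \<open>l *s x\<close>.\<close>
  have "card (span {l *s x} \<times> N) = card ((\<lambda>(a, b). a + b) ` (span {l *s x} \<times> N))"
  proof (rule card_image [symmetric], rule inj_onI, clarify)
    fix a b a' b' assume *: "a \<in> span {l *s x}" "b \<in> N" "a' \<in> span {l *s x}" "b' \<in> N" "a + b = a' + b'"
    then have "a - a' = b' - b" by (simp add: algebra_simps)
    moreover have "a - a' \<in> span {x}" "b' - b \<in> N"
      using * lx N(1) by (auto intro: span_diff subspace_diff)
    ultimately have "b' - b \<in> span {x} \<inter> N" "a - a' = b' - b" by simp_all
    then have "b' - b = 0" "a - a' = 0" using N(2) by simp_all
    then show "a = a' \<and> b = b'" by simp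
  qed
  also have "\<dots> \<le> card {z. n *s z = 0}"
  proof (rule card_mono)
    have "n *s (a + b) = 0" if "a \<in> span {l *s x}" "b \<in> N" for a b
    proof -
      obtain k where "a = k *s l *s x" using \<open>a \<in> span {l *s x}\<close> unfolding span_singleton by blast
      then have "n *s a = k *s n *s l *s x" by (simp only: scale_left_commute)
      also have "n *s l *s x = 0" using has_order_iff[OF ordl, of n] by simp
      finally have "n *s a = 0" by simp
      then show ?thesis using n that(2) by (simp add: scale_right_distrib)
    qed
    then show "(\<lambda>(a, b). a + b) ` (span {l *s x} \<times> N) \<subseteq> {z. n *s z = 0}" by auto
  qed simp
  also have "\<dots> \<le> CARD('k) ^ (2 * Polynomial.degree n)"
    by (rule torsion[OF has_order_nonzero[OF y(2)]])
  finally have "card N \<le> card (span {y})"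
    by (simp add: card_cartesian_product card_cyclic[OF ordl] card_cyclic[OF y(2)]
        mult_2 power_add)
  then have "N = span {y}" using yN by (metis card_seteq finite)
  moreover have "\<exists>a b. z = a *s x + b *s y" for z
  proof -
    obtain a where "z - a *s x \<in> span {y}" using split \<open>N = span {y}\<close> by blast
    then obtain b where "z - a *s x = b *s y" unfolding span_singleton by blast
    then have "z = a *s x + b *s y" by (simp add: algebra_simps)
    then show ?thesis by blast
  qed
  ultimately show ?thesis using that x y(2) N(2) by blast
qed

end

section \<open>Uniqueness of the characteristic\<close>

lemma ring_of_type_algebra_simps [simp]:
  "carrier (ring_of_type_algebra :: 'a::ring_1 ring) = UNIV"
  "monoid.mult (ring_of_type_algebra :: 'a::ring_1 ring) = (*)"
  "monoid.one (ring_of_type_algebra :: 'a::ring_1 ring) = 1"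
  "ring.zero (ring_of_type_algebra :: 'a::ring_1 ring) = 0"
  "ring.add (ring_of_type_algebra :: 'a::ring_1 ring) = (+)"
  by (simp_all add: ring_of_type_algebra_def)

definition multiples :: "'a::comm_semiring_1 \<Rightarrow> 'a set"
  where "multiples f = {a. f dvd a}"

lemma ideal_multiples: "ideal (multiples f) A_ring"
proof (rule idealI)
  show "ring A_ring" by (rule ring_from_type_algebra)
  interpret A: ring A_ring by (rule ring_from_type_algebra)
  show "subgroup (multiples f) (add_monoid A_ring)"
  proof (rule A.add.subgroupI)
    fix a assume "a \<in> multiples f"
    moreover have "\<ominus>\<^bsub>A_ring\<^esub> a = - a" by (rule A.minus_equality) simp_all
    ultimately show "\<ominus>\<^bsub>A_ring\<^esub> a \<in> multiples f" by (simp add: multiples_def)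
  qed (auto simp: multiples_def)
qed (simp_all add: multiples_def)

lemma ideal_eq_multiples:
  assumes "ideal I A_ring"
  obtains f where "I = multiples f"
proof -
  have sub: "additive_subgroup I A_ring" using assms by (rule ideal.axioms(1))
  obtain f where "I = {a. f dvd a}"
    by (rule poly_ideal_principal[of I])
      (use additive_subgroup.zero_closed[OF sub] additive_subgroup.a_closed[OF sub]
        ideal.I_l_closed[OF assms] in auto)
  then show ?thesis using that by (simp add: multiples_def)
qed

lemma multiples_eq_iff: "multiples f = multiples g \<longleftrightarrow> f dvd g \<and> g dvd f"
  unfolding multiples_def set_eq_iff mem_Collect_eq by (meson dvd_refl dvd_trans)

lemma multiples_eq_zero_iff: "multiples f = {0} \<longleftrightarrow> f = 0"
  unfolding multiples_def set_eq_iff mem_Collect_eq singleton_iff by (metis dvd_0_left_iff dvd_refl)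

lemma ideal_prod_multiples:
  fixes f g :: "'k::Fields.field poly"
  shows "ideal_prod A_ring (multiples f) (multiples g) = multiples (f * g)"
proof (intro subset_antisym subsetI)
  fix a assume "a \<in> ideal_prod A_ring (multiples f) (multiples g)"
  then show "a \<in> multiples (f * g)"
    by (induction rule: ideal_prod.induct) (auto simp: multiples_def mult_dvd_mono)
next
  fix a assume "a \<in> multiples (f * g)"
  then obtain b where "a = (f * g) * b" unfolding multiples_def by (auto elim: dvdE)
  then have "a = f * (g * b)" by (simp add: mult.assoc)
  then show "a \<in> ideal_prod A_ring (multiples f) (multiples g)"
    using ideal_prod.prod[of f "multiples f" "g * b" "multiples g" A_ring]
    by (simp add: multiples_def)
qed

lemma foldr_ideal_prod_multiples:
  fixes fs :: "'k::Fields.field poly list"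
  shows "foldr (ideal_prod A_ring) (map multiples fs) (carrier A_ring) = multiples (prod_list fs)"
proof (induction fs)
  case Nil
  show ?case by (simp add: multiples_def)
qed (simp add: ideal_prod_multiples)

text \<open>
  The coset of \<open>a\<close> modulo the ideal generated by \<open>f\<close>.
\<close>

definition residue :: "'a::comm_ring_1 \<Rightarrow> 'a \<Rightarrow> 'a set"
  where "residue f a = {b. f dvd b - a}"

lemma residue_eq_iff: "residue f a = residue f b \<longleftrightarrow> f dvd a - b"
proof
  assume "residue f a = residue f b"
  moreover have "a \<in> residue f a" by (simp add: residue_def)
  ultimately show "f dvd a - b" by (simp add: residue_def)
next
  assume ab: "f dvd a - b"
  have "f dvd c - a \<longleftrightarrow> f dvd c - b" for c
    using dvd_add_left_iff[OF ab, of "c - a"] by simp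
  then show "residue f a = residue f b" by (simp add: residue_def)
qed

lemma coset_multiples: "multiples f +>\<^bsub>A_ring\<^esub> a = residue f a"
proof (intro subset_antisym subsetI)
  fix b assume "b \<in> residue f a"
  then have "b - a \<in> multiples f" "b = (b - a) + a" by (simp_all add: residue_def multiples_def)
  then have "\<exists>h\<in>multiples f. b = h + a" by blast
  then show "b \<in> multiples f +>\<^bsub>A_ring\<^esub> a" by (simp add: a_r_coset_def')
qed (auto simp: a_r_coset_def' residue_def multiples_def)

abbreviation cyclic_module :: "'k::Fields.field poly \<Rightarrow> ('k poly, 'k poly set) module"
  where "cyclic_module f \<equiv> quotient_module A_ring (multiples f)"

lemma carrier_cyclic_module: "carrier (cyclic_module f) = range (residue f)"
  unfolding quotient_module_def FactRing_def ring.defs module.defs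
  by (auto simp: A_RCOSETS_def' coset_multiples)

lemma cyclic_module_add:
  "residue f a \<oplus>\<^bsub>cyclic_module f\<^esub> residue f b = residue f (a + b)"
proof -
  interpret ideal "multiples f" A_ring by (rule ideal_multiples)
  show ?thesis
    using a_rcos_sum[of a b]
    unfolding quotient_module_def FactRing_def ring.defs module.defs by (simp add: coset_multiples)
qed

lemma cyclic_module_smult:
  "a \<odot>\<^bsub>cyclic_module f\<^esub> residue f b = residue f (a * b)"
proof -
  interpret ideal "multiples f" A_ring by (rule ideal_multiples)
  show ?thesis
    using rcoset_mult_add[of a b]
    unfolding quotient_module_def FactRing_def ring.defs module.defs by (simp add: coset_multiples)
qed

lemma carrier_direct_sum_Nil: "carrier (direct_sum []) = {[]}"
  by (simp add: direct_sum_def ring.defs)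

lemma carrier_direct_sum_Cons:
  "carrier (direct_sum (M # Ms)) = (\<lambda>(x, xs). x # xs) ` (carrier M \<times> carrier (direct_sum Ms))"
  using RDirProd_list_carrier[of M Ms] by (simp add: direct_sum_def ring.defs)

lemma Cons_in_direct_sum:
  "x # xs \<in> carrier (direct_sum (M # Ms)) \<longleftrightarrow> x \<in> carrier M \<and> xs \<in> carrier (direct_sum Ms)"
  by (auto simp: carrier_direct_sum_Cons)

lemma direct_sum_add_Nil: "xs \<oplus>\<^bsub>direct_sum []\<^esub> ys = []"
  by (simp add: direct_sum_def ring.defs monoid.defs)

lemma direct_sum_add_Cons:
  assumes "x \<in> carrier M" "y \<in> carrier M" "xs \<in> carrier (direct_sum Ms)" "ys \<in> carrier (direct_sum Ms)"
  shows "(x # xs) \<oplus>\<^bsub>direct_sum (M # Ms)\<^esub> (y # ys) = (x \<oplus>\<^bsub>M\<^esub> y) # (xs \<oplus>\<^bsub>direct_sum Ms\<^esub> ys)"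
  using ring_hom_add[OF RDirProd_list_hom1[of M Ms], of "(x, xs)" "(y, ys)"] assms
  by (simp add: direct_sum_def ring.defs RDirProd_carrier) (simp add: RDirProd_def DirProd_def monoid.defs)

lemma direct_sum_smult_Nil: "a \<odot>\<^bsub>direct_sum []\<^esub> xs = []"
  by (simp add: direct_sum_def ring.defs module.defs)

lemma direct_sum_smult_Cons:
  "a \<odot>\<^bsub>direct_sum (M # Ms)\<^esub> (x # xs) = (a \<odot>\<^bsub>M\<^esub> x) # (a \<odot>\<^bsub>direct_sum Ms\<^esub> xs)"
  by (simp add: direct_sum_def ring.defs module.defs)

text \<open>
  The \<open>g\<close>-torsion of \<open>M\<close>. Comparing with \<open>0 \<odot> x\<close> instead of the zero of \<open>M\<close> makes the
  definition depend on the scalar action alone; hence it is transported by any bijection that respects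
  the scalar action, and is computed componentwise in direct sums.
\<close>

definition torsion :: "('k::Fields.field poly, 'b) module \<Rightarrow> 'k poly \<Rightarrow> 'b set"
  where "torsion M g = {x \<in> carrier M. g \<odot>\<^bsub>M\<^esub> x = 0 \<odot>\<^bsub>M\<^esub> x}"

lemma card_torsion_iso:
  assumes iso: "modules_isomorphic A_ring M N"
    and closed: "\<And>a x. x \<in> carrier M \<Longrightarrow> a \<odot>\<^bsub>M\<^esub> x \<in> carrier M"
  shows "card (torsion M g) = card (torsion N g)"
proof -
  obtain h where h: "bij_betw h (carrier M) (carrier N)"
    and smult: "\<And>a x. x \<in> carrier M \<Longrightarrow> h (a \<odot>\<^bsub>M\<^esub> x) = a \<odot>\<^bsub>N\<^esub> h x"
    using iso by (auto simp: modules_isomorphic_def module_iso_def)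
  have "g \<odot>\<^bsub>N\<^esub> h x = 0 \<odot>\<^bsub>N\<^esub> h x \<longleftrightarrow> g \<odot>\<^bsub>M\<^esub> x = 0 \<odot>\<^bsub>M\<^esub> x" if "x \<in> carrier M" for x
    using h that closed by (metis bij_betw_imp_inj_on inj_on_eq_iff smult)
  then have "h ` torsion M g = torsion N g"
    unfolding torsion_def bij_betw_imp_surj_on[OF h, symmetric] by auto
  moreover have "inj_on h (torsion M g)"
    using h by (auto simp: torsion_def bij_betw_def intro: inj_on_subset)
  ultimately show ?thesis by (metis card_image)
qed

lemma card_torsion_direct_sum_Cons:
  "card (torsion (direct_sum (M # Ms)) g) = card (torsion M g) * card (torsion (direct_sum Ms) g)"
proof -
  have "torsion (direct_sum (M # Ms)) g
      = (\<lambda>(x, xs). x # xs) ` (torsion M g \<times> torsion (direct_sum Ms) g)"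
    by (auto simp: torsion_def carrier_direct_sum_Cons direct_sum_smult_Cons)
  moreover have "inj_on (\<lambda>(x, xs). x # xs) (torsion M g \<times> torsion (direct_sum Ms) g)"
    by (auto simp: inj_on_def)
  ultimately show ?thesis by (simp add: card_image card_cartesian_product)
qed

lemma card_torsion_direct_sum_Nil:
  fixes g :: "'k::Fields.field poly"
  shows "card (torsion (direct_sum [] :: ('k poly, 'b list) module) g) = 1"
proof -
  have "torsion (direct_sum [] :: ('k poly, 'b list) module) g = {[]}"
    by (auto simp: torsion_def carrier_direct_sum_Nil direct_sum_smult_Nil)
  then show ?thesis by simp
qed

text \<open>
  Modulo \<open>f = p^v * u\<close>, with \<open>u\<close> prime to \<open>p\<close>, the elements killed by a high power of \<open>p\<close> are the
  multiples \<open>u * s\<close>, and \<open>s\<close> matters only modulo \<open>p^v\<close>. So the count recovers the \<open>p\<close>-adic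
  valuation \<open>v\<close> of \<open>f\<close>.
\<close>

lemma card_torsion_cyclic:
  fixes p u :: "'k::{Fields.field, finite} poly"
  assumes p: "Factorial_Ring.irreducible p" and u: "\<not> p dvd u" and "v \<le> n"
  shows "card (torsion (cyclic_module (p ^ v * u)) (p ^ n)) = CARD('k) ^ (v * Polynomial.degree p)"
proof -
  let ?f = "p ^ v * u" and ?P = "polys_below (Polynomial.degree (p ^ v)) :: 'k poly set"
  have "p \<noteq> 0" "u \<noteq> 0" using p u by auto
  have cop: "coprime (p ^ k) u" for k
    by (rule poly_coprime_power_left[OF poly_irreducible_coprime[OF p u]])
  have "?f dvd p ^ n * r \<longleftrightarrow> u dvd r" for r
  proof
    assume "?f dvd p ^ n * r"
    then have "u dvd p ^ n * r" by (rule dvd_mult_right)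
    then show "u dvd r" using cop poly_coprime_dvd_mult by (metis coprime_commute)
  next
    assume "u dvd r"
    then show "?f dvd p ^ n * r" using \<open>v \<le> n\<close> by (simp add: le_imp_power_dvd mult_dvd_mono)
  qed
  then have mem: "residue ?f r \<in> torsion (cyclic_module ?f) (p ^ n) \<longleftrightarrow> u dvd r" for r
    unfolding torsion_def carrier_cyclic_module mem_Collect_eq cyclic_module_smult residue_eq_iff
    by simp
  have "torsion (cyclic_module ?f) (p ^ n) = residue ?f ` {r. u dvd r}"
  proof (intro subset_antisym subsetI)
    fix C assume C: "C \<in> torsion (cyclic_module ?f) (p ^ n)"
    then have "C \<in> range (residue ?f)" by (simp add: torsion_def carrier_cyclic_module)
    then obtain r where "C = residue ?f r" by (rule rangeE)
    with C show "C \<in> residue ?f ` {r. u dvd r}" using mem by simp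
  next
    fix C assume "C \<in> residue ?f ` {r. u dvd r}"
    then obtain r where "C = residue ?f r" "u dvd r" by (rule imageE) simp
    then show "C \<in> torsion (cyclic_module ?f) (p ^ n)" using mem by simp
  qed
  moreover have "{r. u dvd r} = range ((*) u)" by (auto elim: dvdE)
  ultimately have tors: "torsion (cyclic_module ?f) (p ^ n) = range (\<lambda>s. residue ?f (u * s))"
    by (simp add: image_image)
  have "bij_betw (\<lambda>s. residue ?f (u * s)) ?P (torsion (cyclic_module ?f) (p ^ n))"
    unfolding bij_betw_def
  proof
    have red: "?f dvd u * s - u * t \<longleftrightarrow> p ^ v dvd s - t" for s t
      using dvd_mult_cancel_left[of u "p ^ v" "s - t"] \<open>u \<noteq> 0\<close>
      by (simp add: right_diff_distrib mult.commute)
    show "inj_on (\<lambda>s. residue ?f (u * s)) ?P"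
    proof (rule inj_onI)
      fix s t assume st: "s \<in> ?P" "t \<in> ?P" "residue ?f (u * s) = residue ?f (u * t)"
      then have "s - t = 0"
        by (intro dvd_in_polys_below_zero[of "p ^ v"] diff_in_polys_below) (simp_all add: residue_eq_iff red)
      then show "s = t" by simp
    qed
    have "residue ?f (u * s) \<in> (\<lambda>s. residue ?f (u * s)) ` ?P" for s
    proof
      show "residue ?f (u * s) = residue ?f (u * (s mod p ^ v))"
        unfolding residue_eq_iff red by (simp add: minus_mod_eq_mult_div)
      show "s mod p ^ v \<in> ?P" by (rule mod_in_polys_below) (simp add: \<open>p \<noteq> 0\<close>)
    qed
    then show "(\<lambda>s. residue ?f (u * s)) ` ?P = torsion (cyclic_module ?f) (p ^ n)"
      unfolding tors by blast
  qed
  then have "card (torsion (cyclic_module ?f) (p ^ n)) = card ?P"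
    by (metis bij_betw_same_card)
  then show ?thesis using \<open>p \<noteq> 0\<close> by (simp add: card_polys_below degree_power_eq)
qed

text \<open>
  Valuations add up over the product of the \<open>f\<close> in the list, and cardinalities multiply over
  the summands. A suitable \<open>N\<close> is the largest valuation that occurs.
\<close>

lemma card_torsion_cyclic_sum:
  fixes p :: "'k::{Fields.field, finite} poly"
  assumes p: "Factorial_Ring.irreducible p" and "0 \<notin> set fs"
  shows "\<exists>v u N. prod_list fs = p ^ v * u \<and> \<not> p dvd u \<and>
    (\<forall>n\<ge>N. card (torsion (direct_sum (map cyclic_module fs)) (p ^ n))
      = CARD('k) ^ (v * Polynomial.degree p))"
  using assms(2)
proof (induction fs)
  case Nil
  have "prod_list [] = p ^ 0 * 1" "\<not> p dvd 1"
    using Factorial_Ring.irreducible_not_unit[OF p] by simp_all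
  then show ?case by (intro exI[of _ 0] exI[of _ 1]) (simp add: card_torsion_direct_sum_Nil)
next
  case (Cons f fs)
  then obtain v u N where IH: "prod_list fs = p ^ v * u" "\<not> p dvd u"
    "\<And>n. N \<le> n \<Longrightarrow> card (torsion (direct_sum (map cyclic_module fs)) (p ^ n))
      = CARD('k) ^ (v * Polynomial.degree p)"
    by auto
  have "f \<noteq> 0" using Cons.prems by auto
  then obtain w t where f: "f = p ^ w * t" "\<not> p dvd t" using poly_split_power[OF p] by metis
  have "prod_list (f # fs) = p ^ (w + v) * (t * u)"
    by (simp add: IH(1) f(1) power_add)
  moreover have "\<not> p dvd t * u"
    using poly_coprime_dvd_mult[OF poly_irreducible_coprime[OF p f(2)]] IH(2) by blast
  moreover have "card (torsion (direct_sum (map cyclic_module (f # fs))) (p ^ n))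
      = CARD('k) ^ ((w + v) * Polynomial.degree p)" if "max w N \<le> n" for n
    using that IH(3)[of n] card_torsion_cyclic[OF p f(2), of w n]
    by (simp add: card_torsion_direct_sum_Cons f(1) distrib_right power_add)
  ultimately show ?case by blast
qed

text \<open>
  Two decompositions of one module have torsion of the same size, hence the products of their
  moduli have the same valuation at each irreducible \<open>p\<close>. By \<open>poly_not_dvd_prime_power\<close> such
  polynomials divide each other.
\<close>

lemma prod_list_dvd_of_iso:
  fixes fs gs :: "'k::{Fields.field, finite} poly list" and M :: "('k poly, 'b) module"
  assumes closed: "\<And>a x. x \<in> carrier M \<Longrightarrow> a \<odot>\<^bsub>M\<^esub> x \<in> carrier M"
    and fs: "0 \<notin> set fs" "modules_isomorphic A_ring M (direct_sum (map cyclic_module fs))"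
    and gs: "0 \<notin> set gs" "modules_isomorphic A_ring M (direct_sum (map cyclic_module gs))"
  shows "prod_list fs dvd prod_list gs"
proof (rule ccontr)
  assume "\<not> prod_list fs dvd prod_list gs"
  moreover have "prod_list fs \<noteq> 0" using fs(1) by (simp add: prod_list_zero_iff)
  ultimately obtain p k where p: "Factorial_Ring.irreducible p"
    and k: "p ^ k dvd prod_list fs" "\<not> p ^ k dvd prod_list gs"
    using poly_not_dvd_prime_power by blast
  obtain v u N where fs': "prod_list fs = p ^ v * u" "\<not> p dvd u"
    "\<And>n. N \<le> n \<Longrightarrow> card (torsion (direct_sum (map cyclic_module fs)) (p ^ n))
      = CARD('k) ^ (v * Polynomial.degree p)"
    using card_torsion_cyclic_sum[OF p fs(1)] by blast
  obtain v' u' N' where gs': "prod_list gs = p ^ v' * u'" "\<not> p dvd u'"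
    "\<And>n. N' \<le> n \<Longrightarrow> card (torsion (direct_sum (map cyclic_module gs)) (p ^ n))
      = CARD('k) ^ (v' * Polynomial.degree p)"
    using card_torsion_cyclic_sum[OF p gs(1)] by blast
  have "CARD('k) ^ (v * Polynomial.degree p) = CARD('k) ^ (v' * Polynomial.degree p)"
    using fs'(3)[of "max N N'"] gs'(3)[of "max N N'"]
      card_torsion_iso[OF fs(2) closed] card_torsion_iso[OF gs(2) closed]
    by simp
  then have "v * Polynomial.degree p = v' * Polynomial.degree p"
    using two_le_card_field[where 'k = 'k] by (simp add: power_inject_exp)
  then have "v = v'" using poly_irreducible_degree_pos[OF p] by simp
  then show False
    using k unfolding fs'(1) gs'(1) poly_power_dvd_split_iff[OF p fs'(2)]
      poly_power_dvd_split_iff[OF p gs'(2)] by simp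
qed

text \<open>
  By \<open>prod_list_dvd_of_iso\<close> in both directions, the products belonging to two decompositions
  generate the same ideal, so the definite description has a value.
\<close>

theorem euler_poincare_eq:
  fixes fs :: "'k::{Fields.field, finite} poly list" and M :: "('k poly, 'b) module"
  assumes closed: "\<And>a x. x \<in> carrier M \<Longrightarrow> a \<odot>\<^bsub>M\<^esub> x \<in> carrier M"
    and fs: "0 \<notin> set fs" "modules_isomorphic A_ring M (direct_sum (map cyclic_module fs))"
  shows "euler_poincare A_ring M = multiples (prod_list fs)"
  unfolding euler_poincare_def
proof (rule the_equality)
  have "map (quotient_module A_ring) (map multiples fs) = map cyclic_module fs" by simp
  then show "\<exists>Js. (\<forall>J\<in>set Js. ideal J A_ring \<and> J \<noteq> {\<zero>\<^bsub>A_ring\<^esub>}) \<and>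
      modules_isomorphic A_ring M (direct_sum (map (quotient_module A_ring) Js)) \<and>
      multiples (prod_list fs) = foldr (ideal_prod A_ring) Js (carrier A_ring)"
    using fs foldr_ideal_prod_multiples[of fs, symmetric]
    by (intro exI[of _ "map multiples fs"])
      (auto simp: ideal_multiples multiples_eq_zero_iff simp del: map_map)
next
  fix I assume "\<exists>Js. (\<forall>J\<in>set Js. ideal J A_ring \<and> J \<noteq> {\<zero>\<^bsub>A_ring\<^esub>}) \<and>
      modules_isomorphic A_ring M (direct_sum (map (quotient_module A_ring) Js)) \<and>
      I = foldr (ideal_prod A_ring) Js (carrier A_ring)"
  then obtain Js where Js: "\<And>J. J \<in> set Js \<Longrightarrow> ideal J A_ring \<and> J \<noteq> {0}"
    and iso: "modules_isomorphic A_ring M (direct_sum (map (quotient_module A_ring) Js))"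
    and I: "I = foldr (ideal_prod A_ring) Js (carrier A_ring)"
    by auto
  have "\<exists>g. J = multiples g" if "J \<in> set Js" for J
    using Js[OF that] ideal_eq_multiples by blast
  then obtain gen where gen: "\<And>J. J \<in> set Js \<Longrightarrow> J = multiples (gen J)" by metis
  define gs where "gs = map gen Js"
  have Js_eq: "Js = map multiples gs"
    unfolding gs_def map_map by (rule map_idI [symmetric]) (simp add: gen [symmetric])
  have "map (quotient_module A_ring) Js = map cyclic_module gs"
    unfolding Js_eq by simp
  with iso have iso': "modules_isomorphic A_ring M (direct_sum (map cyclic_module gs))" by simp
  have "0 \<notin> set gs" using Js[of "multiples 0"] unfolding Js_eq by (auto simp: multiples_eq_zero_iff)
  then have "prod_list fs dvd prod_list gs" "prod_list gs dvd prod_list fs"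
    using prod_list_dvd_of_iso[OF closed] fs iso' by blast+
  then show "I = multiples (prod_list fs)"
    unfolding I Js_eq foldr_ideal_prod_multiples multiples_eq_iff by blast
qed

section \<open>Sums of two cyclic modules\<close>

context finite_poly_module
begin

text \<open>
  The isomorphism sends \<open>a *s x + b *s y\<close> to the pair of residues of \<open>a\<close> and \<open>b\<close>. It is well
  defined and injective because the two cyclic submodules meet trivially.
\<close>

lemma two_cyclic_iso:
  fixes M :: "('k poly, 'b) module"
  assumes x: "has_order x m" and y: "has_order y n" and inter: "span {x} \<inter> span {y} = {0}"
    and gen: "\<And>z. \<exists>a b. z = a *s x + b *s y"
    and M: "carrier M = UNIV" "\<And>u v. u \<oplus>\<^bsub>M\<^esub> v = u + v" "\<And>a u. a \<odot>\<^bsub>M\<^esub> u = a *s u"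
  shows "modules_isomorphic A_ring M (direct_sum [cyclic_module m, cyclic_module n])"
proof -
  have key: "a *s x + b *s y = a' *s x + b' *s y \<longleftrightarrow> m dvd a - a' \<and> n dvd b - b'" for a b a' b'
  proof
    assume "a *s x + b *s y = a' *s x + b' *s y"
    then have eq: "(a - a') *s x = (b' - b) *s y"
      by (simp add: scale_left_diff_distrib algebra_simps)
    moreover have "(a - a') *s x \<in> span {x}" "(b' - b) *s y \<in> span {y}"
      by (simp_all add: span_base span_scale)
    ultimately have "(a - a') *s x = 0" "(b' - b) *s y = 0" using inter by auto
    then have "m dvd a - a'" "n dvd b' - b" using x y by (simp_all add: has_order_iff)
    then show "m dvd a - a' \<and> n dvd b - b'" by (simp add: dvd_diff_commute)
  next
    assume "m dvd a - a' \<and> n dvd b - b'"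
    then have "a *s x = a' *s x" "b *s y = b' *s y"
      by (simp_all add: has_order_eq_iff[OF x] has_order_eq_iff[OF y])
    then show "a *s x + b *s y = a' *s x + b' *s y" by simp
  qed
  obtain \<alpha> \<beta> where coord: "\<And>z. z = \<alpha> z *s x + \<beta> z *s y" using gen by metis
  define h where "h z = [residue m (\<alpha> z), residue n (\<beta> z)]" for z
  have h: "h (a *s x + b *s y) = [residue m a, residue n b]" for a b
    using coord[of "a *s x + b *s y", symmetric] unfolding key h_def by (simp add: residue_eq_iff)
  let ?D = "direct_sum [cyclic_module m, cyclic_module n]"
  have D: "carrier ?D = (\<lambda>(a, b). [residue m a, residue n b]) ` UNIV"
    by (auto simp: carrier_direct_sum_Cons carrier_direct_sum_Nil carrier_cyclic_module image_iff)
  have "bij_betw h UNIV (carrier ?D)"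
    unfolding bij_betw_def
  proof
    show "inj h"
    proof (rule injI)
      fix u v assume "h u = h v"
      then have "\<alpha> u *s x + \<beta> u *s y = \<alpha> v *s x + \<beta> v *s y"
        unfolding key by (simp add: h_def residue_eq_iff)
      then show "u = v" using coord by metis
    qed
    show "range h = carrier ?D"
    proof (intro subset_antisym subsetI)
      fix w assume "w \<in> carrier ?D"
      then obtain a b where "w = h (a *s x + b *s y)" unfolding D h by auto
      then show "w \<in> range h" by simp
    qed (auto simp: D h_def)
  qed
  moreover have "h (u + v) = h u \<oplus>\<^bsub>?D\<^esub> h v" for u v
  proof -
    have "u + v = (\<alpha> u + \<alpha> v) *s x + (\<beta> u + \<beta> v) *s y"
      by (subst (1) coord[of u], subst (1) coord[of v]) (simp add: scale_left_distrib)
    then have "h (u + v) = [residue m (\<alpha> u + \<alpha> v), residue n (\<beta> u + \<beta> v)]"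
      by (simp add: h)
    also have "\<dots> = h u \<oplus>\<^bsub>?D\<^esub> h v"
      by (simp add: h_def direct_sum_add_Cons direct_sum_add_Nil cyclic_module_add
          carrier_cyclic_module Cons_in_direct_sum carrier_direct_sum_Nil)
    finally show ?thesis .
  qed
  moreover have "h (c *s u) = c \<odot>\<^bsub>?D\<^esub> h u" for c u
  proof -
    have "c *s u = (c * \<alpha> u) *s x + (c * \<beta> u) *s y"
      by (subst (1) coord[of u]) (simp add: scale_right_distrib)
    then have "h (c *s u) = [residue m (c * \<alpha> u), residue n (c * \<beta> u)]"
      by (simp add: h)
    also have "\<dots> = c \<odot>\<^bsub>?D\<^esub> h u"
      by (simp add: h_def direct_sum_smult_Cons direct_sum_smult_Nil cyclic_module_smult)
    finally show ?thesis .
  qed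
  ultimately have "h \<in> module_iso A_ring M ?D" by (simp add: module_iso_def M)
  then show ?thesis by (auto simp: modules_isomorphic_def)
qed

end

section \<open>Ore polynomials over a finite field\<close>

lemma finite_field_power_card:
  fixes c :: "'k::{Fields.field, finite}"
  shows "c ^ CARD('k) = c"
proof (cases "c = 0")
  case False
  let ?U = "UNIV - {0 :: 'k}"
  have "bij_betw ((*) c) ?U ?U"
    by (rule bij_betwI[where g = "\<lambda>x. x / c"]) (use False in auto)
  then have "(\<Prod>x\<in>?U. c * x) = \<Prod>?U"
    by (rule prod.reindex_bij_betw)
  then have "c ^ card ?U * \<Prod>?U = 1 * \<Prod>?U"
    by (simp add: prod.distrib)
  moreover have "\<Prod>?U \<noteq> 0" by simp
  ultimately have "c ^ card ?U = 1" using mult_right_cancel by blast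
  moreover have "CARD('k) = Suc (card ?U)"
    by (rule card.remove) simp_all
  ultimately show ?thesis by (simp only: power_Suc mult_1_right)
qed (simp add: finite_UNIV_card_ge_0)

text \<open>
  The polynomial \<open>(T + 1)^q - T^q - 1\<close> has degree below \<open>q\<close> and vanishes at all \<open>q\<close> elements of
  the field, so it is zero. This yields the additivity of the \<open>q\<close>-power map without writing \<open>q\<close> as a
  power of the characteristic.
\<close>

lemma finite_field_binomial_eq_0:
  assumes "0 < i" "i < CARD('k::{Fields.field, finite})"
  shows "of_nat (CARD('k) choose i) = (0 :: 'k)"
proof -
  let ?q = "CARD('k)"
  define f :: "'k poly" where "f = [:1, 1:] ^ ?q - Polynomial.monom 1 ?q - 1"
  have coeff: "Polynomial.coeff f j = of_nat (?q choose j) - (if j = ?q then 1 else 0) - (if j = 0 then 1 else 0)" for j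
    by (cases "j \<le> ?q") (auto simp: f_def coeff_linear_poly_power coeff_eq_0 binomial_eq_0 degree_linear_power)
  have "poly f c = 0" for c
    by (simp add: f_def poly_monom finite_field_power_card)
  then have "{c. poly f c = 0} = UNIV" by simp
  have "f = 0"
  proof (rule ccontr)
    assume "f \<noteq> 0"
    then have "?q \<le> Polynomial.degree f"
      using card_poly_roots_bound[of f] \<open>{c. poly f c = 0} = UNIV\<close> by simp
    moreover have "f \<in> polys_below ?q"
      using assms by (auto simp: polys_below_def coeff binomial_eq_0)
    ultimately show False using \<open>f \<noteq> 0\<close> by (simp add: polys_below_iff)
  qed
  then show ?thesis using coeff[of i] assms by simp
qed

lemma ore_apply_eq_sum:
  assumes "Polynomial.degree f \<le> n"
  shows "ore_apply q f x = (\<Sum>i\<le>n. Polynomial.coeff f i * x ^ (q ^ i))"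
  unfolding ore_apply_def
  by (rule sum.mono_neutral_left) (use assms in \<open>auto simp: coeff_eq_0\<close>)

lemma ore_apply_0_left: "ore_apply q 0 x = 0"
  by (simp add: ore_apply_def)

lemma ore_apply_1_left: "ore_apply q 1 x = x"
  by (simp add: ore_apply_def)

lemma ore_apply_add_left: "ore_apply q (f + g) x = ore_apply q f x + ore_apply q g x"
proof -
  let ?n = "max (Polynomial.degree f) (Polynomial.degree g)"
  have "Polynomial.degree (f + g) \<le> ?n" by (rule degree_add_le_max)
  then show ?thesis
    by (simp add: ore_apply_eq_sum[of _ ?n] distrib_right sum.distrib)
qed

lemma ore_apply_sum_left: "ore_apply q (\<Sum>i\<in>I. f i) x = (\<Sum>i\<in>I. ore_apply q (f i) x)"
  by (induction I rule: infinite_finite_induct) (simp_all add: ore_apply_0_left ore_apply_add_left)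

lemma ore_apply_monom: "ore_apply q (Polynomial.monom a n) x = a * x ^ (q ^ n)"
proof -
  have "ore_apply q (Polynomial.monom a n) x
      = (\<Sum>i\<le>n. Polynomial.coeff (Polynomial.monom a n) i * x ^ (q ^ i))"
    by (rule ore_apply_eq_sum[OF degree_monom_le])
  also have "\<dots> = (\<Sum>i\<le>n. if i = n then a * x ^ (q ^ i) else 0)"
    by (rule sum.cong) simp_all
  finally show ?thesis by simp
qed

text \<open>
  The top coefficient of the product is the product of the leading coefficient of \<open>f\<close> with a
  power of that of \<open>g\<close>.
\<close>

lemma ore_mult_degree:
  fixes f g :: "'l::Fields.field poly"
  assumes "f \<noteq> 0" "g \<noteq> 0"
  shows "ore_mult q f g \<noteq> 0"
    and "Polynomial.degree (ore_mult q f g) = Polynomial.degree f + Polynomial.degree g"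
proof -
  let ?m = "Polynomial.degree f" and ?n = "Polynomial.degree g"
  let ?c = "\<lambda>i j. Polynomial.coeff f i * Polynomial.coeff g j ^ (q ^ i)"
  have "Polynomial.coeff (ore_mult q f g) (?m + ?n)
      = (\<Sum>i\<le>?m. \<Sum>j\<le>?n. if i + j = ?m + ?n then ?c i j else 0)"
    by (simp add: ore_mult_def coeff_sum)
  also have "\<dots> = (\<Sum>i\<le>?m. if i = ?m then \<Sum>j\<le>?n. if j = ?n then ?c i j else 0 else 0)"
    by (intro sum.cong refl) (auto intro!: sum.neutral)
  also have "\<dots> = ?c ?m ?n" by simp
  finally have c: "Polynomial.coeff (ore_mult q f g) (?m + ?n) \<noteq> 0" using assms by simp
  then show "ore_mult q f g \<noteq> 0" by auto
  have "Polynomial.degree (ore_mult q f g) \<le> ?m + ?n"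
    unfolding ore_mult_def
    by (intro degree_sum_le finite_atMost) (auto intro: order.trans[OF degree_monom_le])
  then show "Polynomial.degree (ore_mult q f g) = ?m + ?n"
    using le_degree[OF c] by simp
qed

text \<open>
  An Ore polynomial of degree \<open>n\<close> acts as an ordinary polynomial of degree \<open>q^n\<close>. The condition
  on \<open>q\<close> keeps the exponents \<open>q^i\<close> distinct.
\<close>

lemma card_ore_kernel:
  fixes f :: "'l::Fields.field poly"
  assumes "f \<noteq> 0" "2 \<le> q"
  shows "card {x. ore_apply q f x = 0} \<le> q ^ Polynomial.degree f"
proof -
  let ?n = "Polynomial.degree f"
  define F where "F = (\<Sum>i\<le>?n. Polynomial.monom (Polynomial.coeff f i) (q ^ i))"
  have "poly F x = ore_apply q f x" for x
    by (simp add: F_def ore_apply_def poly_sum poly_monom)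
  moreover have "Polynomial.coeff F (q ^ ?n) \<noteq> 0"
  proof -
    have "Polynomial.coeff F (q ^ ?n) = (\<Sum>i\<le>?n. if i = ?n then Polynomial.coeff f i else 0)"
      unfolding F_def coeff_sum using assms(2) by (intro sum.cong refl) simp
    then show ?thesis using assms(1) by simp
  qed
  then have "F \<noteq> 0" by auto
  moreover have "Polynomial.degree F \<le> q ^ ?n"
    unfolding F_def using assms(2)
    by (intro degree_sum_le finite_atMost)
      (auto intro!: order.trans[OF degree_monom_le] power_increasing)
  ultimately show ?thesis using card_poly_roots_bound[of F] by simp
qed

section \<open>Drinfeld modules of rank two\<close>

context drinfeld_module_rank2
begin

lemma iota_props: "\<iota> (a + b) = \<iota> a + \<iota> b" "\<iota> (a * b) = \<iota> a * \<iota> b" "\<iota> 1 = 1" "\<iota> 0 = 0"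
proof -
  show add: "\<iota> (a + b) = \<iota> a + \<iota> b" for a b using ring_hom_add[OF iota_hom] by simp
  show "\<iota> (a * b) = \<iota> a * \<iota> b" using ring_hom_mult[OF iota_hom] by simp
  show "\<iota> 1 = 1" using ring_hom_one[OF iota_hom] by simp
  show "\<iota> 0 = 0" using add[of 0 0] by (metis add.right_neutral add_left_imp_eq)
qed

lemma iota_of_nat: "\<iota> (of_nat n) = of_nat n"
  by (induction n) (simp_all add: iota_props)

lemma iota_nonzero: "c \<noteq> 0 \<Longrightarrow> \<iota> c \<noteq> 0"
  using iota_props(2)[of c "inverse c"] iota_props(3) by auto

lemma frobenius_add: "((x::'l) + y) ^ CARD('k) = x ^ CARD('k) + y ^ CARD('k)"
proof -
  have binom: "of_nat (CARD('k) choose i) = (0 :: 'l)" if "0 < i" "i < CARD('k)" for i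
    using finite_field_binomial_eq_0[OF that] iota_of_nat[of "CARD('k) choose i"] iota_props(4) by simp
  have "(x + y) ^ CARD('k) = (\<Sum>i\<le>CARD('k). of_nat (CARD('k) choose i) * x ^ i * y ^ (CARD('k) - i))"
    by (rule binomial_ring)
  also have "\<dots> = (\<Sum>i\<in>{0, CARD('k)}. of_nat (CARD('k) choose i) * x ^ i * y ^ (CARD('k) - i))"
    by (rule sum.mono_neutral_right) (auto simp: binom)
  also have "\<dots> = x ^ CARD('k) + y ^ CARD('k)" using two_le_card_field[where 'k = 'k] by simp
  finally show ?thesis .
qed

lemma frobenius_power_add: "((x::'l) + y) ^ (CARD('k) ^ i) = x ^ (CARD('k) ^ i) + y ^ (CARD('k) ^ i)"
  by (induction i arbitrary: x y) (simp_all add: power_mult frobenius_add)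

lemma frobenius_power_sum:
  fixes f :: "'i \<Rightarrow> 'l"
  shows "(\<Sum>j\<in>J. f j) ^ (CARD('k) ^ i) = (\<Sum>j\<in>J. f j ^ (CARD('k) ^ i))"
  by (induction J rule: infinite_finite_induct) (simp_all add: frobenius_power_add zero_power)

lemma ore_apply_add_right:
  "ore_apply CARD('k) f ((x::'l) + y) = ore_apply CARD('k) f x + ore_apply CARD('k) f y"
  by (simp add: ore_apply_def frobenius_power_add distrib_left sum.distrib)

text \<open>
  The Ore product represents composition because the powers of the \<open>q\<close>-power map are additive:
  \<open>\<tau>^i\<close> can be moved past the sum that defines the action of \<open>g\<close>.
\<close>

lemma ore_apply_ore_mult:
  fixes x :: 'l
  shows "ore_apply CARD('k) (ore_mult CARD('k) f g) x = ore_apply CARD('k) f (ore_apply CARD('k) g x)"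
proof -
  have "ore_apply CARD('k) (ore_mult CARD('k) f g) x
    = (\<Sum>i\<le>Polynomial.degree f. \<Sum>j\<le>Polynomial.degree g.
        Polynomial.coeff f i * Polynomial.coeff g j ^ (CARD('k) ^ i) * x ^ (CARD('k) ^ (i + j)))"
    by (simp add: ore_mult_def ore_apply_sum_left ore_apply_monom)
  also have "\<dots> = (\<Sum>i\<le>Polynomial.degree f. Polynomial.coeff f i *
      (\<Sum>j\<le>Polynomial.degree g. Polynomial.coeff g j * x ^ (CARD('k) ^ j)) ^ (CARD('k) ^ i))"
  proof (rule sum.cong)
    fix i
    have "(a * x ^ (CARD('k) ^ j)) ^ (CARD('k) ^ i) = a ^ (CARD('k) ^ i) * x ^ (CARD('k) ^ (i + j))"
      for a j
      by (simp add: power_mult_distrib power_add mult.commute flip: power_mult)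
    then show "(\<Sum>j\<le>Polynomial.degree g.
          Polynomial.coeff f i * Polynomial.coeff g j ^ (CARD('k) ^ i) * x ^ (CARD('k) ^ (i + j)))
        = Polynomial.coeff f i *
          (\<Sum>j\<le>Polynomial.degree g. Polynomial.coeff g j * x ^ (CARD('k) ^ j)) ^ (CARD('k) ^ i)"
      by (simp only: frobenius_power_sum sum_distrib_left mult.assoc)
  qed simp
  finally show ?thesis by (simp add: ore_apply_def)
qed

lemma Phi_props:
  "\<Phi> (a + b) = \<Phi> a + \<Phi> b" "\<Phi> (a * b) = ore_mult CARD('k) (\<Phi> a) (\<Phi> b)" "\<Phi> 1 = 1" "\<Phi> 0 = 0"
proof -
  show add: "\<Phi> (a + b) = \<Phi> a + \<Phi> b" for a b
    using ring_hom_add[OF Phi_hom] by (simp add: ore_ring_def)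
  show "\<Phi> (a * b) = ore_mult CARD('k) (\<Phi> a) (\<Phi> b)"
    using ring_hom_mult[OF Phi_hom] by (simp add: ore_ring_def)
  show "\<Phi> 1 = 1" using ring_hom_one[OF Phi_hom] by (simp add: ore_ring_def)
  show "\<Phi> 0 = 0" using add[of 0 0] by (metis add.right_neutral add_left_imp_eq)
qed

text \<open>
  This is where the rank enters: the leading coefficient \<open>a\<^sub>3\<close> of the image of \<open>T\<close> is nonzero,
  so multiplication by \<open>T\<close> raises the degree of the image by exactly two.
\<close>

lemma degree_Phi:
  assumes "a \<noteq> 0"
  shows "\<Phi> a \<noteq> 0 \<and> Polynomial.degree (\<Phi> a) = 2 * Polynomial.degree a"
  using assms
proof (induction a)
  case (pCons c a)
  obtain a\<^sub>2 a\<^sub>3 where a\<^sub>3: "a\<^sub>3 \<noteq> 0" and T: "\<Phi> [:0, 1:] = [:\<gamma> [:0, 1:], a\<^sub>2, a\<^sub>3:]"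
    using Phi_T by blast
  have split: "\<Phi> (pCons c a) = [:\<iota> c:] + ore_mult CARD('k) (\<Phi> [:0, 1:]) (\<Phi> a)"
  proof -
    have "pCons c a = [:c:] + [:0, 1:] * a" by simp
    then show ?thesis by (simp only: Phi_props Phi_const)
  qed
  show ?case
  proof (cases "a = 0")
    case True
    have "\<Phi> (pCons c a) = [:\<iota> c:]" using True by (simp add: Phi_const)
    moreover have "\<iota> c \<noteq> 0" using True pCons.hyps iota_nonzero by simp
    ultimately show ?thesis using True by simp
  next
    case False
    then have IH: "\<Phi> a \<noteq> 0" "Polynomial.degree (\<Phi> a) = 2 * Polynomial.degree a"
      using pCons.IH by simp_all
    have "\<Phi> [:0, 1:] \<noteq> 0" "Polynomial.degree (\<Phi> [:0, 1:]) = 2" using a\<^sub>3 by (simp_all add: T)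
    then have deg: "Polynomial.degree (ore_mult CARD('k) (\<Phi> [:0, 1:]) (\<Phi> a)) = 2 + 2 * Polynomial.degree a"
      using ore_mult_degree(2)[of "\<Phi> [:0, 1:]" "\<Phi> a" "CARD('k)"] IH by simp
    then have "Polynomial.degree (\<Phi> (pCons c a)) = 2 + 2 * Polynomial.degree a"
      unfolding split by (subst degree_add_eq_right) simp_all
    then show ?thesis using False by auto
  qed
qed simp

end

section \<open>The module of points\<close>

lemma drinfeld_point_module_simps:
  fixes \<Phi> :: "'k::{Fields.field, finite} poly \<Rightarrow> 'l::{Fields.field, finite} poly"
  shows "carrier (drinfeld_point_module \<Phi>) = UNIV"
    and "x \<oplus>\<^bsub>drinfeld_point_module \<Phi>\<^esub> y = x + y"
    and "a \<odot>\<^bsub>drinfeld_point_module \<Phi>\<^esub> x = ore_apply CARD('k) (\<Phi> a) x"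
  by (simp_all add: drinfeld_point_module_def ring.defs module.defs)

context drinfeld_module_rank2
begin

lemma finite_poly_module_points: "finite_poly_module (\<lambda>a x. ore_apply CARD('k) (\<Phi> a) x)"
  by unfold_locales
    (simp_all add: Phi_props ore_apply_add_left ore_apply_add_right ore_apply_ore_mult ore_apply_1_left)

lemma card_points_torsion:
  assumes "a \<noteq> 0"
  shows "card {x. ore_apply CARD('k) (\<Phi> a) x = 0} \<le> CARD('k) ^ (2 * Polynomial.degree a)"
  using card_ore_kernel[of "\<Phi> a" "CARD('k)"] degree_Phi[OF assms] two_le_card_field[where 'k = 'k]
  by simp

end

theorem proposition2p1:
  fixes \<iota> :: "'k::{Fields.field, finite} \<Rightarrow> 'l::{Fields.field, finite}"
    and \<gamma> :: "'k poly \<Rightarrow> 'l"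
    and \<Phi> :: "'k poly \<Rightarrow> 'l poly"
  assumes "drinfeld_module_rank2 \<iota> \<gamma> \<Phi>"
  shows "\<exists>I\<^sub>1 I\<^sub>2. ideal I\<^sub>1 A_ring \<and> ideal I\<^sub>2 A_ring \<and>
    modules_isomorphic A_ring (drinfeld_point_module \<Phi>)
      (direct_sum [quotient_module A_ring I\<^sub>1, quotient_module A_ring I\<^sub>2]) \<and>
    euler_poincare A_ring (drinfeld_point_module \<Phi>) = ideal_prod A_ring I\<^sub>1 I\<^sub>2"
proof -
  interpret drinfeld_module_rank2 \<iota> \<gamma> \<Phi> by (rule assms)
  interpret points: finite_poly_module "\<lambda>a x. ore_apply CARD('k) (\<Phi> a) x"
    by (rule finite_poly_module_points)
  obtain x y m n where xy: "points.has_order x m" "points.has_order y n"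
    "points.span {x} \<inter> points.span {y} = {0}"
    "\<And>z. \<exists>a b. z = ore_apply CARD('k) (\<Phi> a) x + ore_apply CARD('k) (\<Phi> b) y"
    using points.two_cyclic_summands[OF card_points_torsion] by metis
  have iso: "modules_isomorphic A_ring (drinfeld_point_module \<Phi>)
      (direct_sum [cyclic_module m, cyclic_module n])"
    by (rule points.two_cyclic_iso[OF xy]) (rule drinfeld_point_module_simps)+
  have "euler_poincare A_ring (drinfeld_point_module \<Phi>) = multiples (prod_list [m, n])"
  proof (rule euler_poincare_eq)
    show "0 \<notin> set [m, n]" using xy(1,2) points.has_order_nonzero by fastforce
  qed (use iso in \<open>simp_all add: drinfeld_point_module_simps\<close>)
  then have "euler_poincare A_ring (drinfeld_point_module \<Phi>)
      = ideal_prod A_ring (multiples m) (multiples n)"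
    by (simp add: ideal_prod_multiples)
  with iso show ?thesis using ideal_multiples by blast
qed

end
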